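(* For every $\mathbf{u}\in\{0,1\}^N$, let $\overline u_j=\sum_{s=1}^N\mathbb{1}\{r_s=j,u_s=1\}$ and $\overline u=\sum_{s=1}^N\mathbb{1}\{u_s=1\}$. For $k\in\{0,1\}$ let $$\rho_{j,k}=\frac{\sum_{s=1}^N\mathbb{1}\{r_s=j,u_s=k\}}{\sum_{s=1}^N\mathbb{1}\{u_s=k\}},\qquad w_{j,k}=\frac{\sum_{s=1}^N\big(\mathbb{1}\{r_s=j,u_s=k\}-\rho_{j,k}\big)^2}{\sum_{s=1}^N\mathbb{1}\{u_s=k\}-1}.$$ Let $Q_i=\sum_{s=1}^N\mathbb{1}\{Z_s=i,u_s=1\}$. Under the sharp null hypothesis and given $\mathbf{u}$, the mean and the variance of the cell counts $N_{ij}$ are $$\mathbb{E}[N_{ij}]=\frac{\overline u_j}{\overline u}\mathbb{E}[Q_i]+\frac{N_{\cdot j}-\overline u_j}{N-\overline u}\big(N_{i\cdot}-\mathbb{E}[Q_i]\big),$$ $$\mathrm{Var}[N_{ij}]=(w_{j,1}-w_{j,0})\mathbb{E}[Q_i]-\Big(\frac{w_{j,1}}{\overline u}+\frac{w_{j,0}}{N-\overline u}\Big)\big(\mathbb{E}[Q_i]^2+\mathrm{Var}[Q_i]\big)+\frac{N_{i\cdot}(N-\overline u-N_{i\cdot}+2\mathbb{E}[Q_i])w_{j,0}}{N-\overline u}+\mathrm{Var}[Q_i](\rho_{j,1}-\rho_{j,0})^2.$$ The moments of the $Q_i$ can be computed from their exact joint distribution, which is $$\mathbb{P}\big((Q_1,\dots,Q_I)=\mathbf{q}\big)=\frac{\exp(\gamma\boldsymbol\delta^\top\mathbf{q})\operatorname{kernel}(\mathbf{q}\mid\mathbf{N}_{I\cdot},\mathbf{u})}{\sum_{\mathbf{q}'\in\Omega_{\mathbf{q}}}\exp(\gamma\boldsymbol\delta^\top\mathbf{q}')\operatorname{kernel}(\mathbf{q}'\mid\mathbf{N}_{I\cdot},\mathbf{u})}.$$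 The covariances of the cell counts are as follows. Let $i\ne i'$, $j\neq j'$, and $D_{jj'}=\rho_{j,1}\rho_{j',1}+\rho_{j,0}\rho_{j',0}-\rho_{j,1}\rho_{j',0}-\rho_{j',1}\rho_{j,0}$. For $1<\overline u<N-1$: $$\mathrm{Cov}[N_{ij},N_{ij'}]=A_1+A_0+D_{jj'}\mathrm{Var}[Q_i],$$ with $A_1=\frac{\rho_{j,1}\rho_{j',1}}{\overline u-1}(\mathbb{E}[Q_i^2]-\overline u\,\mathbb{E}[Q_i])$ and $A_0=\frac{\rho_{j,0}\rho_{j',0}}{N-\overline u-1}\big(N_{i\cdot}(N_{i\cdot}-N+\overline u)+\mathbb{E}[Q_i^2]-(2N_{i\cdot}-N+\overline u)\mathbb{E}[Q_i]\big)$; $$\mathrm{Cov}[N_{ij},N_{i'j}]=(\rho_{j,1}^2+\rho_{j,0}^2-2\rho_{j,1}\rho_{j,0})\mathrm{Cov}[Q_i,Q_{i'}]+B_1+B_0,$$ with $B_1=-\frac{\overline u_j(\overline u-\overline u_j)}{\overline u^2(\overline u-1)}\mathbb{E}[Q_iQ_{i'}]$ and $B_0=\frac{(N_{\cdot j}-\overline u_j)(N_{\cdot j}-\overline u_j-N+\overline u)}{(N-\overline u)^2(N-\overline u-1)}\big(\mathbb{E}[Q_iQ_{i'}]+N_{i\cdot}N_{i'\cdot}-N_{i\cdot}\mathbb{E}[Q_{i'}]-N_{i'\cdot}\mathbb{E}[Q_i]\big)$; $$\mathrm{Cov}[N_{ij},N_{i'j'}]=D_{jj'}\mathrm{Cov}[Q_i,Q_{i'}]+C_1+C_0,$$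 with $C_1=\frac{\rho_{j,1}\rho_{j',1}}{\overline u-1}\mathbb{E}[Q_iQ_{i'}]$ and $C_0=\frac{\rho_{j,0}\rho_{j',0}}{N-\overline u-1}\big(\mathbb{E}[Q_iQ_{i'}]+N_{i\cdot}N_{i'\cdot}-N_{i\cdot}\mathbb{E}[Q_{i'}]-N_{i'\cdot}\mathbb{E}[Q_i]\big)$. For $\overline u=N-1$ the same three formulas hold with $A_0,B_0,C_0$ omitted; for $\overline u=1$ they hold with $A_1,B_1,C_1$ omitted. For $\overline u=0$ or $N$: $$\mathrm{Cov}[N_{ij},N_{ij'}]=\frac{-N_{\cdot j}N_{\cdot j'}N_{i\cdot}(N-N_{i\cdot})}{N^2(N-1)},\quad\mathrm{Cov}[N_{ij},N_{i'j}]=\frac{-N_{\cdot j}(N-N_{\cdot j})N_{i\cdot}N_{i'\cdot}}{N^2(N-1)},\quad\mathrm{Cov}[N_{ij},N_{i'j'}]=\frac{N_{\cdot j}N_{\cdot j'}N_{i\cdot}N_{i'\cdot}}{N^2(N-1)}.$$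
   Context: There are $N$ subjects, $I$ treatment levels and $J$ outcome levels, and positive integers $N_{1\cdot},\dots,N_{I\cdot}$ with $\sum_i N_{i\cdot}=N$. Let $\mathcal{Z}(\mathbf{N}_{I\cdot})=\{\mathbf{z}\in\{1,\dots,I\}^N:\ |\{s:z_s=i\}|=N_{i\cdot}\ \forall i\}$. The outcome vector $\mathbf{r}\in\{1,\dots,J\}^N$ is fixed (sharp null hypothesis of no treatment effect), and $N_{\cdot j}=|\{s:r_s=j\}|$. Let $\gamma\ge0$ and $\boldsymbol\delta=(\delta_1,\dots,\delta_I)\in\{0,1\}^I$ be sensitivity parameters. All probabilities, expectations, variances and covariances are with respect to the random vector $\mathbf{Z}\in\mathcal{Z}(\mathbf{N}_{I\cdot})$ with $$\mathbb{P}(\mathbf{Z}=\mathbf{z})=\frac{\exp\{\gamma\sum_{s=1}^N\delta_{z_s}u_s\}}{\sum_{\mathbf{b}\in\mathcal{Z}(\mathbf{N}_{I\cdot})}\exp\{\gamma\sum_{s=1}^N\delta_{b_s}u_s\}}.$$ Cell counts: $N_{ij}=\sum_{s=1}^N\mathbb{1}\{Z_s=i,r_s=j\}$. Further, $$\Omega_{\mathbf{q}}=\Big\{\mathbf{q}\in\mathbb{Z}_{\ge0}^I:\sum_iq_i=\overline u,\ \max(0,N_{i\cdot}+\overline u-N)\le q_i\le\min(N_{i\cdot},\overline u)\ \forall i\Big\},$$ $$\operatorname{kernel}(\mathbf{q}\mid\mathbf{N}_{I\cdot},\mathbf{u})=\Big|\Big\{\mathbf{z}\in\mathcal{Z}(\mathbf{N}_{I\cdot}):\sum_{s=1}^N\mathbb{1}\{z_s=i,u_s=1\}=q_i\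 \forall i\Big\}\Big|.$$
   Formalization: In w_{j,k} the sum of squares runs only over subjects s with u_s = k, not over all s = 1..N; with the sum over all subjects the variance formula is false (e.g. N=4, margins (2,2), r=(1,2,1,2), u=(1,1,0,0), γ=0). Quotients with denominator 0 are read as 0. *)

theory Defs
  imports "HOL-Probability.Probability"
begin

text \<open>
  Subjects, treatment levels and outcome levels are the elements of three arbitrary finite (hence
  nonempty) types \<open>'s\<close>, \<open>'t\<close>, \<open>'o\<close>; thus \<open>N = CARD('s)\<close>, \<open>I = CARD('t)\<close> and \<open>J = CARD('o)\<close>.
  The treatment margins are \<open>n :: 't \<Rightarrow> nat\<close>, the fixed outcome vector is \<open>r :: 's \<Rightarrow> 'o\<close>, and
  \<open>u :: 's \<Rightarrow> nat\<close> and \<open>\<delta> :: 't \<Rightarrow> nat\<close> take values in \<open>{0, 1}\<close>.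
\<close>

definition assignments :: "('t \<Rightarrow> nat) \<Rightarrow> ('s::finite \<Rightarrow> 't::finite) set" where
  "assignments n = {z. \<forall>i. card {s. z s = i} = n i}"

definition assignment_weight ::
    "real \<Rightarrow> ('t \<Rightarrow> nat) \<Rightarrow> ('s \<Rightarrow> nat) \<Rightarrow> ('s::finite \<Rightarrow> 't::finite) \<Rightarrow> real" where
  "assignment_weight \<gamma> \<delta> u z = exp (\<gamma> * (\<Sum>s\<in>UNIV. real (\<delta> (z s)) * real (u s)))"

text \<open>
  The law of the random vector \<open>Z\<close>. The use of \<^const>\<open>embed_pmf\<close> is legitimate as soon as the
  margins add up to the number of subjects; see \<open>pmf_assignment_pmf\<close> below.
\<close>

definition assignment_pmf ::
    "('t \<Rightarrow> nat) \<Rightarrow> real \<Rightarrow> ('t \<Rightarrow> nat) \<Rightarrow> ('s \<Rightarrow> nat) \<Rightarrow> ('s::finite \<Rightarrow> 't::finite) pmf" where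
  "assignment_pmf n \<gamma> \<delta> u = embed_pmf (\<lambda>z.
     if z \<in> assignments n
     then assignment_weight \<gamma> \<delta> u z / (\<Sum>b\<in>assignments n. assignment_weight \<gamma> \<delta> u b)
     else 0)"

definition cell_count ::
    "('s \<Rightarrow> 'o) \<Rightarrow> 't \<Rightarrow> 'o \<Rightarrow> ('s::finite \<Rightarrow> 't::finite) \<Rightarrow> nat" where
  "cell_count r i j z = (\<Sum>s\<in>UNIV. of_bool (z s = i \<and> r s = j))"

definition treated_u_count ::
    "('s \<Rightarrow> nat) \<Rightarrow> ('s::finite \<Rightarrow> 't::finite) \<Rightarrow> 't \<Rightarrow> nat" where
  "treated_u_count u z i = (\<Sum>s\<in>UNIV. of_bool (z s = i \<and> u s = 1))"

definition outcome_total :: "('s::finite \<Rightarrow> 'o) \<Rightarrow> 'o \<Rightarrow> nat" where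
  "outcome_total r j = card {s. r s = j}"

definition u_total :: "('s::finite \<Rightarrow> nat) \<Rightarrow> nat" where
  "u_total u = (\<Sum>s\<in>UNIV. of_bool (u s = 1))"

definition u_outcome_total :: "('s::finite \<Rightarrow> 'o) \<Rightarrow> ('s \<Rightarrow> nat) \<Rightarrow> 'o \<Rightarrow> nat" where
  "u_outcome_total r u j = (\<Sum>s\<in>UNIV. of_bool (r s = j \<and> u s = 1))"

text \<open>
  \<open>stratum_mean r u j k\<close> and \<open>stratum_var r u j k\<close> are the mean \<open>\<rho>\<^sub>j\<^sub>,\<^sub>k\<close> and the sample variance
  \<open>w\<^sub>j\<^sub>,\<^sub>k\<close> of the indicator of outcome \<open>j\<close> within the stratum \<open>{s. u s = k}\<close>. The sum of squares
  runs over the stratum only: a sum over all subjects would add a spurious \<open>\<rho>\<^sup>2\<close> for every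
  subject outside the stratum, and the variance formula would then be false. Over an empty stratum both are \<open>0\<close>, and over a one-element
  stratum the variance is \<open>0\<close>, since division by zero yields zero.
\<close>

definition stratum_mean :: "('s::finite \<Rightarrow> 'o) \<Rightarrow> ('s \<Rightarrow> nat) \<Rightarrow> 'o \<Rightarrow> nat \<Rightarrow> real" where
  "stratum_mean r u j k =
     (\<Sum>s\<in>UNIV. of_bool (r s = j \<and> u s = k)) / (\<Sum>s\<in>UNIV. of_bool (u s = k))"

definition stratum_var :: "('s::finite \<Rightarrow> 'o) \<Rightarrow> ('s \<Rightarrow> nat) \<Rightarrow> 'o \<Rightarrow> nat \<Rightarrow> real" where
  "stratum_var r u j k =
     (\<Sum>s | u s = k. (of_bool (r s = j \<and> u s = k) - stratum_mean r u j k)\<^sup>2)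
       / ((\<Sum>s\<in>UNIV. of_bool (u s = k)) - 1)"

text \<open>The bounds are stated over \<open>int\<close> so that \<open>n i + ub - N\<close> is not truncated.\<close>

definition Omega_q :: "'s::finite itself \<Rightarrow> ('t::finite \<Rightarrow> nat) \<Rightarrow> nat \<Rightarrow> ('t \<Rightarrow> nat) set" where
  "Omega_q _ n ub = {q. (\<Sum>i\<in>UNIV. q i) = ub \<and>
     (\<forall>i. max 0 (int (n i) + int ub - int CARD('s)) \<le> int (q i) \<and>
          int (q i) \<le> min (int (n i)) (int ub))}"

definition kernel_count :: "('t::finite \<Rightarrow> nat) \<Rightarrow> ('t \<Rightarrow> nat) \<Rightarrow> ('s::finite \<Rightarrow> nat) \<Rightarrow> nat" where
  "kernel_count q n u = card {z \<in> (assignments n :: ('s \<Rightarrow> 't) set).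
     \<forall>i. (\<Sum>s\<in>UNIV. of_bool (z s = i \<and> u s = 1)) = q i}"

definition covariance :: "'a pmf \<Rightarrow> ('a \<Rightarrow> real) \<Rightarrow> ('a \<Rightarrow> real) \<Rightarrow> real" where
  "covariance p X Y = measure_pmf.expectation p
     (\<lambda>x. (X x - measure_pmf.expectation p X) * (Y x - measure_pmf.expectation p Y))"

lemma exists_with_fibre_cards:
  fixes n :: "'t::finite \<Rightarrow> nat"
  assumes "finite A" "(\<Sum>i\<in>UNIV. n i) = card A"
  shows "\<exists>z :: 's \<Rightarrow> 't. \<forall>i. card {s \<in> A. z s = i} = n i"
  using assms
proof (induction A arbitrary: n rule: finite_induct)
  case empty
  then show ?case by auto
next
  case (insert a A)
  then have "(\<Sum>i\<in>UNIV. n i) \<noteq> 0" by simp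
  then obtain k where k: "n k > 0" by (auto simp: sum_eq_0_iff)
  define m where "m = n(k := n k - 1)"
  have "(\<Sum>i\<in>UNIV. n i) = n k + (\<Sum>i\<in>UNIV - {k}. n i)"
    by (simp add: sum.remove)
  moreover have "(\<Sum>i\<in>UNIV. m i) = m k + (\<Sum>i\<in>UNIV - {k}. m i)"
    by (simp add: sum.remove)
  moreover have "(\<Sum>i\<in>UNIV - {k}. m i) = (\<Sum>i\<in>UNIV - {k}. n i)"
    by (rule sum.cong) (auto simp: m_def)
  ultimately have "(\<Sum>i\<in>UNIV. m i) = card A"
    using insert k by (simp add: m_def)
  then obtain z :: "'s \<Rightarrow> 't" where z: "\<And>i. card {s \<in> A. z s = i} = m i"
    using insert.IH by blast
  have "card {s \<in> insert a A. (z(a := k)) s = i} = n i" for i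
  proof (cases "i = k")
    case True
    then have "{s \<in> insert a A. (z(a := k)) s = i} = insert a {s \<in> A. z s = i}" by auto
    then show ?thesis using insert.hyps z[of i] True k by (simp add: m_def)
  next
    case False
    then have "{s \<in> insert a A. (z(a := k)) s = i} = {s \<in> A. z s = i}"
      using insert.hyps by auto
    then show ?thesis using z[of i] False by (simp add: m_def)
  qed
  then show ?case by blast
qed

lemma assignments_nonempty:
  assumes "(\<Sum>i\<in>UNIV. n i) = CARD('s::finite)"
  shows "(assignments n :: ('s \<Rightarrow> 't::finite) set) \<noteq> {}"
  using exists_with_fibre_cards[of "UNIV :: 's set" n] assms by (auto simp: assignments_def)

lemma pmf_assignment_pmf:
  fixes z :: "'s::finite \<Rightarrow> 't::finite"
  assumes "(\<Sum>i\<in>UNIV. n i) = CARD('s)"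
  shows "pmf (assignment_pmf n \<gamma> \<delta> u) z =
    (if z \<in> assignments n
     then assignment_weight \<gamma> \<delta> u z / (\<Sum>b\<in>assignments n. assignment_weight \<gamma> \<delta> u b)
     else 0)"
  unfolding assignment_pmf_def
proof (rule pmf_embed_pmf)
  let ?S = "\<Sum>b\<in>(assignments n :: ('s \<Rightarrow> 't) set). assignment_weight \<gamma> \<delta> u b"
  let ?f = "\<lambda>z :: 's \<Rightarrow> 't. if z \<in> assignments n then assignment_weight \<gamma> \<delta> u z / ?S else 0"
  have S: "?S > 0"
    using assignments_nonempty[OF assms]
    by (intro sum_pos) (auto simp: assignment_weight_def)
  show nonneg: "0 \<le> ?f x" for x
    using S by (auto simp: assignment_weight_def)
  have "(\<Sum>x\<in>UNIV. ?f x) = (\<Sum>x\<in>assignments n. assignment_weight \<gamma> \<delta> u x / ?S)"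
    by (intro sum.mono_neutral_cong_right) auto
  also have "\<dots> = 1"
    using S by (simp flip: sum_divide_distrib)
  finally have "(\<Sum>x\<in>UNIV. ?f x) = 1" .
  then show "(\<integral>\<^sup>+ x. ennreal (?f x) \<partial>count_space UNIV) = 1"
    using nonneg by (simp add: nn_integral_count_space_finite sum_ennreal)
qed

end

theory Submission
  imports Defs "HOL-Combinatorics.Transposition"
begin

text \<open>
  The law of \<open>Z\<close> weighs an assignment only through the stratum labels \<open>u\<close>, so it is invariant under
  transposing two subjects of the same stratum. Hence the probability of \<open>Z\<^sub>s = i\<close>, \<open>Z\<^sub>t = i'\<close> with
  \<open>s \<noteq> t\<close> depends only on the strata of \<open>s\<close> and \<open>t\<close>, and is determined by the second moments of the
  stratum totals \<open>Q\<^sub>i\<close> and \<open>N\<^sub>i - Q\<^sub>i\<close>. Splitting each cell count over the two strata, its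
  covariances become one term inside each stratum plus the covariance of the stratum totals weighted
  by differences of the \<open>\<rho>\<close>. The formulas for the terms inside a stratum remain correct for strata of
  size 0 or 1 with \<open>x / 0 = 0\<close>, so the boundary cases for \<open>\<Sum>u\<close> are instances of the general formula.
\<close>

section \<open>Exchangeability inside a stratum and counts of a treatment level\<close>

text \<open>Transpositions are enough as an invariance condition: the arguments below move one
  subject at a time and never call for a general permutation.\<close>

definition exchangeable_on :: "('s \<Rightarrow> 't) pmf \<Rightarrow> 's set \<Rightarrow> bool" where
  "exchangeable_on p S \<longleftrightarrow> (\<forall>s\<in>S. \<forall>t\<in>S. map_pmf (\<lambda>z. z \<circ> Transposition.transpose s t) p = p)"

text \<open>With a stratum as \<open>A\<close> this is Q_i or its complement in the treatment
  margin; with the subjects of one outcome inside a stratum it is the share of N_ij from that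
  stratum.\<close>

definition level_count :: "'s set \<Rightarrow> 't \<Rightarrow> ('s \<Rightarrow> 't) \<Rightarrow> real" where
  "level_count A i z = (\<Sum>s\<in>A. of_bool (z s = i))"

text \<open>
  Given the stratum totals \<open>X\<^sub>i = level_count S i\<close>, the count in \<open>A\<close> has conditional mean
  \<open>|A| / |S| * X\<^sub>i\<close>; thus \<open>within_cov\<close> is the expected conditional covariance of the two counts.
\<close>

definition within_cov ::
    "('s::finite \<Rightarrow> 't::finite) pmf \<Rightarrow> 's set \<Rightarrow> 's set \<Rightarrow> 's set \<Rightarrow> 't \<Rightarrow> 't \<Rightarrow> real" where
  "within_cov p S A B i i' =
     measure_pmf.expectation p (\<lambda>z. level_count A i z * level_count B i' z) -
     real (card A) / real (card S) * (real (card B) / real (card S)) *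
       measure_pmf.expectation p (\<lambda>z. level_count S i z * level_count S i' z)"

section \<open>Covariance on a finite sample space\<close>

lemma integrable_pmf_finite_type [simp]:
  "integrable (measure_pmf (p :: ('a::finite) pmf)) (f :: 'a \<Rightarrow> real)"
  by (rule integrable_measure_pmf_finite) simp

lemma covariance_eq:
  fixes p :: "('a::finite) pmf"
  shows "covariance p X Y = measure_pmf.expectation p (\<lambda>x. X x * Y x)
    - measure_pmf.expectation p X * measure_pmf.expectation p Y"
proof -
  have "(\<lambda>x. (X x - measure_pmf.expectation p X) * (Y x - measure_pmf.expectation p Y)) =
    (\<lambda>x. X x * Y x - measure_pmf.expectation p X * Y x - measure_pmf.expectation p Y * X x
      + measure_pmf.expectation p X * measure_pmf.expectation p Y)"
    by (simp add: algebra_simps)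
  then show ?thesis
    unfolding covariance_def by (simp add: measure_pmf.prob_space)
qed

lemma variance_eq_covariance: "measure_pmf.variance p X = covariance p X X"
  by (simp add: covariance_def power2_eq_square)

lemma covariance_add_left:
  fixes p :: "('a::finite) pmf"
  shows "covariance p (\<lambda>x. X x + X' x) Y = covariance p X Y + covariance p X' Y"
  by (simp add: covariance_eq algebra_simps)

lemma covariance_add_right:
  fixes p :: "('a::finite) pmf"
  shows "covariance p X (\<lambda>x. Y x + Y' x) = covariance p X Y + covariance p X Y'"
  by (simp add: covariance_eq algebra_simps)

section \<open>Pair probabilities under exchangeability\<close>

lemma expectation_exchangeable_on:
  fixes f :: "_ \<Rightarrow> real"
  assumes "exchangeable_on p S" "s \<in> S" "t \<in> S"
  shows "measure_pmf.expectation p (\<lambda>z. f (z \<circ> Transposition.transpose s t)) = measure_pmf.expectation p f"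
proof -
  have "measure_pmf.expectation (map_pmf (\<lambda>z. z \<circ> Transposition.transpose s t) p) f =
        measure_pmf.expectation p (\<lambda>z. f (z \<circ> Transposition.transpose s t))"
    by (rule integral_map_pmf)
  moreover have "map_pmf (\<lambda>z. z \<circ> Transposition.transpose s t) p = p"
    using assms by (simp add: exchangeable_on_def)
  ultimately show ?thesis by simp
qed

text \<open>The case s = t with equal levels is a marginal probability, so first and second moments
  of counts are both sums of this one quantity.\<close>

definition joint_prob :: "('s \<Rightarrow> 't) pmf \<Rightarrow> 't \<Rightarrow> 't \<Rightarrow> 's \<Rightarrow> 's \<Rightarrow> real" where
  "joint_prob p i i' s t = measure_pmf.expectation p (\<lambda>z. of_bool (z s = i) * of_bool (z t = i'))"

lemma joint_prob_transpose:
  assumes "exchangeable_on p S" "a \<in> S" "b \<in> S"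
  shows "joint_prob p i i' (Transposition.transpose a b s) (Transposition.transpose a b t) = joint_prob p i i' s t"
  using expectation_exchangeable_on[OF assms, of "\<lambda>z. of_bool (z s = i) * of_bool (z t = i')"]
  by (simp add: joint_prob_def)

text \<open>Two transpositions carry (s, t) to (s', t'): the first moves s to s' and fixes t, the
  second moves t to t' and fixes s'. If s' = t, the first would also move t; then s and t are
  exchanged first, and s is moved to t' afterwards.\<close>

lemma joint_prob_same_stratum:
  assumes "exchangeable_on p S" "s \<in> S" "t \<in> S" "s \<noteq> t" "s' \<in> S" "t' \<in> S" "s' \<noteq> t'"
  shows "joint_prob p i i' s t = joint_prob p i i' s' t'"
proof (cases "s' = t")
  case True
  have "joint_prob p i i' t s = joint_prob p i i' s t"
    using joint_prob_transpose[OF assms(1,2,3), of i i' s t] by simp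
  moreover have "joint_prob p i i' t t' = joint_prob p i i' t s"
    using joint_prob_transpose[OF assms(1,2,6), of i i' t s] assms True by simp
  ultimately show ?thesis using True by simp
next
  case False
  have "joint_prob p i i' s' t = joint_prob p i i' s t"
    using joint_prob_transpose[OF assms(1,2,5), of i i' s t] assms False by simp
  moreover have "joint_prob p i i' s' t' = joint_prob p i i' s' t"
    using joint_prob_transpose[OF assms(1,3,6), of i i' s' t] assms False by simp
  ultimately show ?thesis by simp
qed

text \<open>A transposition inside one stratum fixes every subject of the other, so the two subjects
  can be moved independently.\<close>

lemma joint_prob_different_strata:
  assumes "exchangeable_on p S" "exchangeable_on p T" "S \<inter> T = {}"
    and "s \<in> S" "s' \<in> S" "t \<in> T" "t' \<in> T"
  shows "joint_prob p i i' s t = joint_prob p i i' s' t'"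
proof -
  have "Transposition.transpose s s' t = t" "Transposition.transpose t t' s' = s'"
    using assms by (auto intro!: transpose_apply_other)
  then show ?thesis
    using joint_prob_transpose[OF assms(1,4,5), of i i' s t]
      joint_prob_transpose[OF assms(2,6,7), of i i' s' t] by simp
qed

lemma joint_prob_diagonal:
  assumes "exchangeable_on p S" "s \<in> S" "t \<in> S"
  shows "joint_prob p i i s s = joint_prob p i i t t"
  using joint_prob_transpose[OF assms, of i i s s] by simp

lemma joint_prob_diagonal_neq: "i \<noteq> i' \<Longrightarrow> joint_prob p i i' s s = 0"
proof -
  assume "i \<noteq> i'"
  then have "(\<lambda>z. of_bool (z s = i) * of_bool (z s = i') :: real) = (\<lambda>_. 0)"
    by auto
  then show ?thesis by (simp add: joint_prob_def)
qed

section \<open>First and second moments of level counts\<close>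

lemma expectation_level_count:
  fixes p :: "('s::finite \<Rightarrow> 't::finite) pmf"
  shows "measure_pmf.expectation p (level_count A i) = (\<Sum>s\<in>A. joint_prob p i i s s)"
proof -
  \<comment> \<open>An indicator is its own square, which writes the first moment in terms of
    diagonal pairs.\<close>
  have "level_count A i = (\<lambda>z. \<Sum>s\<in>A. of_bool (z s = i) * of_bool (z s = i))"
    by (auto simp: level_count_def fun_eq_iff intro!: sum.cong)
  then show ?thesis
    by (simp only: joint_prob_def Bochner_Integration.integral_sum integrable_pmf_finite_type)
qed

lemma expectation_level_count_mult:
  fixes p :: "('s::finite \<Rightarrow> 't::finite) pmf"
  shows "measure_pmf.expectation p (\<lambda>z. level_count A i z * level_count B i' z) =
    (\<Sum>(s, t)\<in>A \<times> B. joint_prob p i i' s t)"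
  by (simp only: level_count_def sum_product joint_prob_def Bochner_Integration.integral_sum integrable_pmf_finite_type
      flip: sum.cartesian_product)

text \<open>All subjects of \<open>S\<close> have the same marginal probability; the instance for
  the whole of \<open>S\<close> eliminates it.\<close>

lemma expectation_level_count_exchangeable:
  fixes p :: "('s::finite \<Rightarrow> 't::finite) pmf"
  assumes "exchangeable_on p S" "A \<subseteq> S"
  shows "measure_pmf.expectation p (level_count A i) =
    real (card A) / real (card S) * measure_pmf.expectation p (level_count S i)"
proof (cases "S = {}")
  case False
  then obtain s where s: "s \<in> S" by blast
  have "measure_pmf.expectation p (level_count B i) = real (card B) * joint_prob p i i s s"
    if "B \<subseteq> S" for B
  proof -
    have "(\<Sum>t\<in>B. joint_prob p i i t t) = (\<Sum>_\<in>B. joint_prob p i i s s)"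
      using that s by (intro sum.cong) (auto intro!: joint_prob_diagonal[OF assms(1)])
    then show ?thesis by (simp add: expectation_level_count)
  qed
  from this[OF assms(2)] this[of S] False show ?thesis by simp
qed (use assms in \<open>simp add: expectation_level_count\<close>)

text \<open>Pairs with one member in each stratum share a single joint probability, and disjointness
  leaves no diagonal. The instance for the full strata eliminates that probability.\<close>

lemma expectation_level_count_mult_cross:
  fixes p :: "('s::finite \<Rightarrow> 't::finite) pmf"
  assumes "exchangeable_on p S" "exchangeable_on p T" "S \<inter> T = {}" "A \<subseteq> S" "B \<subseteq> T"
  shows "measure_pmf.expectation p (\<lambda>z. level_count A i z * level_count B i' z) =
    real (card A) / real (card S) * (real (card B) / real (card T)) *
      measure_pmf.expectation p (\<lambda>z. level_count S i z * level_count T i' z)"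
proof (cases "S = {} \<or> T = {}")
  case False
  then obtain s t where st: "s \<in> S" "t \<in> T" by blast
  have "measure_pmf.expectation p (\<lambda>z. level_count X i z * level_count Y i' z) =
      real (card X) * real (card Y) * joint_prob p i i' s t" if "X \<subseteq> S" "Y \<subseteq> T" for X Y
  proof -
    have "(\<Sum>(s, t)\<in>X \<times> Y. joint_prob p i i' s t) = (\<Sum>_\<in>X \<times> Y. joint_prob p i i' s t)"
      using that st by (intro sum.cong) (auto intro!: joint_prob_different_strata[OF assms(1-3)])
    then show ?thesis
      by (simp add: expectation_level_count_mult card_cartesian_product)
  qed
  from this[OF assms(4,5)] this[of S T] False show ?thesis by simp
qed (use assms in \<open>auto simp: level_count_def\<close>)

text \<open>Pairs of distinct subjects share one joint probability, and diagonal pairs contribute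
  only if the levels agree. The instance for the whole of \<open>S\<close> determines the common
  probability from the moments of the stratum totals.\<close>

lemma expectation_level_count_mult_within:
  fixes p :: "('s::finite \<Rightarrow> 't::finite) pmf"
  assumes "exchangeable_on p S" "A \<subseteq> S" "B \<subseteq> S"
  shows "measure_pmf.expectation p (\<lambda>z. level_count A i z * level_count B i' z) =
    (real (card A) * real (card B) - real (card (A \<inter> B))) / (real (card S) * (real (card S) - 1)) *
      (measure_pmf.expectation p (\<lambda>z. level_count S i z * level_count S i' z)
        - of_bool (i = i') * measure_pmf.expectation p (level_count S i))
    + of_bool (i = i') * (real (card (A \<inter> B)) / real (card S)) *
      measure_pmf.expectation p (level_count S i)"
proof -
  define off where "off X Y = {(s, t) \<in> X \<times> Y. s \<noteq> t}" for X Y :: "'s set"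
  have card_off: "real (card (off X Y)) = real (card X) * real (card Y) - real (card (X \<inter> Y))"
    for X Y
  proof -
    have "X \<times> Y = off X Y \<union> (\<lambda>s. (s, s)) ` (X \<inter> Y)" "off X Y \<inter> (\<lambda>s. (s, s)) ` (X \<inter> Y) = {}"
      by (auto simp: off_def)
    then have "card (X \<times> Y) = card (off X Y) + card ((\<lambda>s. (s, s)) ` (X \<inter> Y))"
      using card_Un_disjoint[OF finite finite] by metis
    then have "card X * card Y = card (off X Y) + card (X \<inter> Y)"
      by (simp add: card_cartesian_product card_image inj_on_def)
    then show ?thesis
      by (simp flip: of_nat_mult)
  qed
  \<comment> \<open>If \<open>S\<close> has no two distinct elements, any \<open>c\<close> satisfies
    this.\<close>
  obtain c where c: "\<And>s t. s \<in> S \<Longrightarrow> t \<in> S \<Longrightarrow> s \<noteq> t \<Longrightarrow> joint_prob p i i' s t = c"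
    using joint_prob_same_stratum[OF assms(1)] by metis
  \<comment> \<open>Needed for \<open>A\<close> and \<open>B\<close>, and once more for
    \<open>S\<close> and \<open>S\<close> to solve for \<open>c\<close>.\<close>
  have decomp: "measure_pmf.expectation p (\<lambda>z. level_count X i z * level_count Y i' z) =
      (real (card X) * real (card Y) - real (card (X \<inter> Y))) * c
      + of_bool (i = i') * measure_pmf.expectation p (level_count (X \<inter> Y) i)"
    if XY: "X \<subseteq> S" "Y \<subseteq> S" for X Y
  proof -
    have "(\<Sum>(s, t)\<in>X \<times> Y. joint_prob p i i' s t) =
        (\<Sum>(s, t)\<in>off X Y. joint_prob p i i' s t) + (\<Sum>(s, t)\<in>(\<lambda>s. (s, s)) ` (X \<inter> Y). joint_prob p i i' s t)"
      by (subst sum.union_disjoint[symmetric]) (auto simp: off_def intro!: sum.cong)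
    also have "(\<Sum>(s, t)\<in>off X Y. joint_prob p i i' s t) = (\<Sum>_\<in>off X Y. c)"
      using XY by (intro sum.cong) (auto simp: off_def intro!: c)
    also have "(\<Sum>(s, t)\<in>(\<lambda>s. (s, s)) ` (X \<inter> Y). joint_prob p i i' s t) =
        (\<Sum>s\<in>X \<inter> Y. joint_prob p i i' s s)"
      by (subst sum.reindex) (auto simp: inj_on_def)
    also have "\<dots> = of_bool (i = i') * measure_pmf.expectation p (level_count (X \<inter> Y) i)"
      by (cases "i = i'") (simp_all add: expectation_level_count joint_prob_diagonal_neq)
    finally show ?thesis
      by (simp add: expectation_level_count_mult card_off)
  qed
  have diag: "measure_pmf.expectation p (level_count (A \<inter> B) i) =
      real (card (A \<inter> B)) / real (card S) * measure_pmf.expectation p (level_count S i)"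
    using assms by (intro expectation_level_count_exchangeable) auto
  show ?thesis
  \<comment> \<open>With at most one subject there are no off-diagonal pairs: the coefficient has
    numerator 0, so its zero denominator is harmless.\<close>
  proof (cases "card S \<le> 1")
    case True
    then have "A = {} \<or> A = S" "B = {} \<or> B = S" "card S = 0 \<or> card S = 1"
      using assms(2,3) by (auto simp: le_Suc_eq card_1_singleton_iff subset_singleton_iff)
    then have "card A * card B = card (A \<inter> B)"
      by auto
    then have "real (card A) * real (card B) - real (card (A \<inter> B)) = 0"
      by (simp flip: of_nat_mult)
    then show ?thesis
      using decomp[OF assms(2,3)] diag by simp
  next
    case False
    have "c = (measure_pmf.expectation p (\<lambda>z. level_count S i z * level_count S i' z)
        - of_bool (i = i') * measure_pmf.expectation p (level_count S i))
        / (real (card S) * (real (card S) - 1))"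
      using decomp[of S S] False by (auto simp: eq_divide_eq) (simp add: algebra_simps)
    then show ?thesis
      using decomp[OF assms(2,3)] diag by simp
  qed
qed


section \<open>Covariance inside a stratum\<close>

lemma expectation_level_count_mult_singleton:
  fixes p :: "('s::finite \<Rightarrow> 't::finite) pmf"
  assumes "exchangeable_on p S" "card S = 1"
  shows "measure_pmf.expectation p (\<lambda>z. level_count S i z * level_count S i' z) =
    of_bool (i = i') * measure_pmf.expectation p (level_count S i)"
  using expectation_level_count_mult_within[OF assms(1) order.refl order.refl, of i i'] assms(2)
  by simp

text \<open>Separates the sizes at which a denominator \<open>card S\<close> or
  \<open>card S - 1\<close> vanishes from those at which field arithmetic applies.\<close>

lemma card_stratum_cases:
  fixes S :: "'s::finite set"
  obtains "S = {}" | "card S = 1" | "real (card S) \<noteq> 0" "real (card S) - 1 \<noteq> 0"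
  by (cases "card S = 0"; cases "card S = 1") auto

text \<open>No diagonal pair lies in \<open>A \<times> B\<close>, and with m = |S| the factors
  combine by 1/(m(m-1)) - 1/m^2 = 1/(m^2(m-1)). For m = 1 one of \<open>A\<close>, \<open>B\<close>
  is empty and both sides are 0.\<close>

lemma within_cov_disjoint:
  fixes p :: "('s::finite \<Rightarrow> 't::finite) pmf"
  assumes "exchangeable_on p S" "A \<subseteq> S" "B \<subseteq> S" "A \<inter> B = {}"
  shows "within_cov p S A B i i' =
    real (card A) / real (card S) * (real (card B) / real (card S)) / (real (card S) - 1) *
      (measure_pmf.expectation p (\<lambda>z. level_count S i z * level_count S i' z)
        - of_bool (i = i') * real (card S) * measure_pmf.expectation p (level_count S i))"
proof (cases rule: card_stratum_cases[of S])
  case 1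
  then show ?thesis using assms by (simp add: within_cov_def level_count_def)
next
  case 2
  then have "A = {} \<or> B = {}"
    using assms(2-4) by (auto simp: card_1_singleton_iff subset_singleton_iff)
  then show ?thesis by (auto simp: within_cov_def level_count_def)
next
  case 3
  then show ?thesis
    unfolding within_cov_def expectation_level_count_mult_within[OF assms(1-3)] assms(4)
    by (simp add: divide_simps) (simp add: algebra_simps)
qed

text \<open>A subject has only one level, so distinct levels remove the diagonal. With a = |A| and m
  = |S| the coefficient is (a^2 - a)/(m(m-1)) - a^2/m^2. For m = 1 the product moment itself is
  0.\<close>

lemma within_cov_same_outcome:
  fixes p :: "('s::finite \<Rightarrow> 't::finite) pmf"
  assumes "exchangeable_on p S" "A \<subseteq> S" "i \<noteq> i'"
  shows "within_cov p S A A i i' =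
    - (real (card A) * (real (card S) - real (card A)) / ((real (card S))\<^sup>2 * (real (card S) - 1))) *
      measure_pmf.expectation p (\<lambda>z. level_count S i z * level_count S i' z)"
proof (cases rule: card_stratum_cases[of S])
  case 1
  then show ?thesis using assms by (simp add: within_cov_def level_count_def)
next
  case 2
  then show ?thesis
    using expectation_level_count_mult_singleton[OF assms(1) 2, of i i'] assms(3)
    unfolding within_cov_def expectation_level_count_mult_within[OF assms(1,2,2)] by simp
next
  case 3
  then show ?thesis
    using assms(3)
    unfolding within_cov_def expectation_level_count_mult_within[OF assms(1,2,2)]
    by (simp add: divide_simps power2_eq_square) (simp add: algebra_simps)
qed

text \<open>The variance of a total under simple random sampling: X draws without replacement from a
  population of size |S| with sample variance \<open>w\<close> have variance w X (1 - X/|S|), here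
  averaged over the stratum total X.\<close>

lemma within_cov_same_cell:
  fixes p :: "('s::finite \<Rightarrow> 't::finite) pmf"
  assumes "exchangeable_on p S" "A \<subseteq> S"
  defines "w \<equiv> (real (card A) - (real (card A))\<^sup>2 / real (card S)) / (real (card S) - 1)"
  shows "within_cov p S A A i i = w * measure_pmf.expectation p (level_count S i)
    - w / real (card S) * measure_pmf.expectation p (\<lambda>z. level_count S i z * level_count S i z)"
proof (cases rule: card_stratum_cases[of S])
  case 1
  then show ?thesis using assms by (simp add: within_cov_def level_count_def)
next
  case 2
  then have "A = {} \<or> A = S"
    using assms(2) by (auto simp: card_1_singleton_iff subset_singleton_iff)
  then show ?thesis
    using expectation_level_count_mult_singleton[OF assms(1) 2, of i i] 2
    by (auto simp: w_def within_cov_def level_count_def)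
next
  case 3
  then show ?thesis
    unfolding within_cov_def expectation_level_count_mult_within[OF assms(1,2,2)] w_def
    by (simp add: divide_simps power2_eq_square) (simp add: algebra_simps)
qed

section \<open>Complementary strata and the covariance over both\<close>

lemma expectation_cong_set_pmf:
  fixes f g :: "'a \<Rightarrow> real"
  assumes "\<And>x. x \<in> set_pmf p \<Longrightarrow> f x = g x"
  shows "measure_pmf.expectation p f = measure_pmf.expectation p g"
  using assms by (intro integral_cong_AE) (auto simp: AE_measure_pmf_iff)

text \<open>\<open>T\<close> is to be the stratum complementary to \<open>S\<close>, and
  \<open>c\<close> the treatment margins. The relation is assumed on the support only, since only
  there are the margins fixed.\<close>

lemma expectation_complement:
  fixes p :: "('s::finite \<Rightarrow> 't::finite) pmf"
  assumes "\<And>z i. z \<in> set_pmf p \<Longrightarrow> level_count T i z = c i - level_count S i z"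
  shows "measure_pmf.expectation p (level_count T i) =
      c i - measure_pmf.expectation p (level_count S i)"
  using expectation_cong_set_pmf[of p "level_count T i" "\<lambda>z. c i - level_count S i z", OF assms]
  by simp

lemma expectation_mult_complement:
  fixes p :: "('s::finite \<Rightarrow> 't::finite) pmf"
  assumes "\<And>z i. z \<in> set_pmf p \<Longrightarrow> level_count T i z = c i - level_count S i z"
  shows "measure_pmf.expectation p (\<lambda>z. level_count S i z * level_count T i' z) =
      c i' * measure_pmf.expectation p (level_count S i)
      - measure_pmf.expectation p (\<lambda>z. level_count S i z * level_count S i' z)"
  using expectation_cong_set_pmf[of p "\<lambda>z. level_count S i z * level_count T i' z"
      "\<lambda>z. c i' * level_count S i z - level_count S i z * level_count S i' z"]
  by (simp add: assms algebra_simps)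

lemma expectation_complement_mult_complement:
  fixes p :: "('s::finite \<Rightarrow> 't::finite) pmf"
  assumes "\<And>z i. z \<in> set_pmf p \<Longrightarrow> level_count T i z = c i - level_count S i z"
  shows "measure_pmf.expectation p (\<lambda>z. level_count T i z * level_count T i' z) =
      measure_pmf.expectation p (\<lambda>z. level_count S i z * level_count S i' z) + c i * c i'
      - c i * measure_pmf.expectation p (level_count S i')
      - c i' * measure_pmf.expectation p (level_count S i)"
  using expectation_cong_set_pmf[of p "\<lambda>z. level_count T i z * level_count T i' z"
      "\<lambda>z. level_count S i z * level_count S i' z + c i * c i' - c i * level_count S i' z
        - c i' * level_count S i z"]
  by (simp add: assms algebra_simps measure_pmf.prob_space)

text \<open>A law of total covariance. Products inside a stratum give \<open>within_cov\<close> plus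
  ratios times a moment of the totals; products across strata give only such moments. Replacing the
  totals of \<open>T\<close> by \<open>c\<close> minus those of \<open>S\<close> reverses the sign
  of their deviations, hence the differences of ratios.\<close>

lemma covariance_two_strata:
  fixes p :: "('s::finite \<Rightarrow> 't::finite) pmf"
  assumes ex: "exchangeable_on p S" "exchangeable_on p T"
    and ST: "S \<inter> T = {}"
    and sub: "A \<subseteq> S" "B \<subseteq> S" "A' \<subseteq> T" "B' \<subseteq> T"
    and margin: "\<And>z i. z \<in> set_pmf p \<Longrightarrow> level_count T i z = c i - level_count S i z"
  shows "covariance p (\<lambda>z. level_count A i z + level_count A' i z)
      (\<lambda>z. level_count B i' z + level_count B' i' z) =
    within_cov p S A B i i' + within_cov p T A' B' i i'
    + (real (card A) / real (card S) - real (card A') / real (card T)) *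
      (real (card B) / real (card S) - real (card B') / real (card T)) *
      covariance p (level_count S i) (level_count S i')"
proof -
  have ET: "measure_pmf.expectation p (level_count T k) =
      c k - measure_pmf.expectation p (level_count S k)" for k
    by (rule expectation_complement) (rule margin)
  have EST: "measure_pmf.expectation p (\<lambda>z. level_count S k z * level_count T l z) =
      c l * measure_pmf.expectation p (level_count S k)
      - measure_pmf.expectation p (\<lambda>z. level_count S k z * level_count S l z)" for k l
    by (rule expectation_mult_complement) (rule margin)
  have ETS: "measure_pmf.expectation p (\<lambda>z. level_count T k z * level_count S l z) =
      c k * measure_pmf.expectation p (level_count S l)
      - measure_pmf.expectation p (\<lambda>z. level_count S k z * level_count S l z)" for k l
    using EST[of l k] by (simp add: mult.commute)
  have ETT: "measure_pmf.expectation p (\<lambda>z. level_count T k z * level_count T l z) =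
      measure_pmf.expectation p (\<lambda>z. level_count S k z * level_count S l z) + c k * c l
      - c k * measure_pmf.expectation p (level_count S l)
      - c l * measure_pmf.expectation p (level_count S k)" for k l
    by (rule expectation_complement_mult_complement) (rule margin)
  have TS: "T \<inter> S = {}" using ST by blast
  \<comment> \<open>Naming the ratios turns the remaining identity into a polynomial one, free of
    divisions.\<close>
  define a a' b b' where ab: "a = real (card A) / real (card S)" "a' = real (card A') / real (card T)"
    "b = real (card B) / real (card S)" "b' = real (card B') / real (card T)"
  show ?thesis
    unfolding covariance_add_left covariance_add_right covariance_eq within_cov_def
      expectation_level_count_mult_cross[OF ex ST sub(1,4)]
      expectation_level_count_mult_cross[OF ex(2,1) TS sub(3,2)]
      expectation_level_count_exchangeable[OF ex(1) sub(1)]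
      expectation_level_count_exchangeable[OF ex(1) sub(2)]
      expectation_level_count_exchangeable[OF ex(2) sub(3)]
      expectation_level_count_exchangeable[OF ex(2) sub(4)]
      ET EST ETS ETT ab[symmetric]
    by (simp add: algebra_simps)
qed

section \<open>Exchangeability of the assignment law\<close>

lemma exchangeable_on_assignment_pmf:
  fixes u :: "'s::finite \<Rightarrow> nat" and n :: "'t::finite \<Rightarrow> nat"
  assumes "(\<Sum>i\<in>UNIV. n i) = CARD('s)"
  shows "exchangeable_on (assignment_pmf n \<gamma> \<delta> u :: ('s \<Rightarrow> 't) pmf) {s. u s = k}"
  unfolding exchangeable_on_def
proof (intro ballI pmf_eqI)
  fix s t and z :: "'s \<Rightarrow> 't"
  assume st: "s \<in> {s. u s = k}" "t \<in> {s. u s = k}"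
  define \<tau> where "\<tau> = Transposition.transpose s t"
  have bij: "bij \<tau>" and inv: "\<tau> \<circ> \<tau> = id" and u: "u (\<tau> x) = u x" for x
    using st by (auto simp: \<tau>_def Transposition.transpose_def)
  have assign: "z \<circ> \<tau> \<in> assignments n \<longleftrightarrow> z \<in> assignments n" for z :: "'s \<Rightarrow> 't"
  proof -
    have "card {x. (z \<circ> \<tau>) x = i} = card {x. z x = i}" for i
    proof -
      have "{x. (z \<circ> \<tau>) x = i} = \<tau> -` {x. z x = i}" by auto
      then show ?thesis
        using card_vimage_inj[of \<tau> "{x. z x = i}"] bij by (simp add: bij_def)
    qed
    then show ?thesis by (simp add: assignments_def)
  qed
  have weight: "assignment_weight \<gamma> \<delta> u (z \<circ> \<tau>) = assignment_weight \<gamma> \<delta> u z" for z :: "'s \<Rightarrow> 't"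
    using sum.reindex_bij_betw[OF bij, of "\<lambda>x. real (\<delta> (z x)) * real (u x)"]
    by (simp add: assignment_weight_def u)
  \<comment> \<open>Since \<open>\<tau>\<close> is an involution, z is the image of
    \<open>z \<circ> \<tau>\<close> alone, so the mapped law at z is the original law at
    \<open>z \<circ> \<tau>\<close>.\<close>
  have "inj (\<lambda>z :: 's \<Rightarrow> 't. z \<circ> \<tau>)"
    by (rule inj_on_inverseI[of _ "\<lambda>z. z \<circ> \<tau>"]) (simp add: comp_assoc inv)
  then have "pmf (map_pmf (\<lambda>z. z \<circ> \<tau>) (assignment_pmf n \<gamma> \<delta> u)) ((z \<circ> \<tau>) \<circ> \<tau>) =
      pmf (assignment_pmf n \<gamma> \<delta> u) (z \<circ> \<tau>)"
    by (rule pmf_map_inj')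
  also have "\<dots> = pmf (assignment_pmf n \<gamma> \<delta> u) z"
    by (simp add: pmf_assignment_pmf[OF assms] assign weight)
  finally show "pmf (map_pmf (\<lambda>z. z \<circ> Transposition.transpose s t) (assignment_pmf n \<gamma> \<delta> u)) z =
      pmf (assignment_pmf n \<gamma> \<delta> u) z"
    by (simp add: comp_assoc inv flip: \<tau>_def)
qed


section \<open>Joint law of the stratum totals\<close>

lemma level_count_empty [simp]: "level_count {} i = (\<lambda>_. 0)"
  by (simp add: level_count_def fun_eq_iff)

lemma level_count_eq_card: "level_count A i z = real (card {s \<in> A. z s = i})" if "finite A"
  using that by (simp add: level_count_def Int_def)

lemma level_count_Un_disjoint:
  assumes "finite A" "finite B" "A \<inter> B = {}"
  shows "level_count (A \<union> B) i z = level_count A i z + level_count B i z"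
  using assms by (simp only: level_count_def sum.union_disjoint)

lemma treated_u_count_eq_level_count:
  "real (treated_u_count u z i) = level_count {s. u s = 1} i z"
  by (simp add: treated_u_count_def level_count_def Int_def conj_commute)

text \<open>Grouping subjects by level shows that the weight depends on z only through the counts
  Q_i; for binary \<open>u\<close>, the number \<open>u s\<close> is the indicator of
  \<open>u s = 1\<close>.\<close>

lemma assignment_weight_eq:
  fixes u :: "'s::finite \<Rightarrow> nat" and z :: "'s \<Rightarrow> 't::finite"
  assumes "\<And>s. u s \<in> {0, 1}"
  shows "assignment_weight \<gamma> \<delta> u z =
    exp (\<gamma> * (\<Sum>i\<in>UNIV. real (\<delta> i) * real (treated_u_count u z i)))"
proof -
  have "(\<Sum>i\<in>UNIV. real (\<delta> i) * real (treated_u_count u z i)) =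
      (\<Sum>i\<in>UNIV. \<Sum>s\<in>UNIV. real (\<delta> i) * of_bool (z s = i \<and> u s = 1))"
    by (simp only: treated_u_count_def of_nat_sum of_nat_of_bool sum_distrib_left)
  also have "\<dots> = (\<Sum>s\<in>UNIV. \<Sum>i\<in>UNIV. if z s = i then real (\<delta> i) * of_bool (u s = 1) else 0)"
    by (subst sum.swap) (intro sum.cong, auto)
  also have "\<dots> = (\<Sum>s\<in>UNIV. real (\<delta> (z s)) * real (u s))"
  proof (intro sum.cong refl)
    fix s
    show "(\<Sum>i\<in>UNIV. if z s = i then real (\<delta> i) * of_bool (u s = 1) else 0) =
        real (\<delta> (z s)) * real (u s)"
      using assms[of s] by auto
  qed
  finally show ?thesis by (simp add: assignment_weight_def)
qed

lemma finite_Omega_q: "finite (Omega_q x n ub :: ('t::finite \<Rightarrow> nat) set)"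
proof (rule finite_subset)
  show "Omega_q x n ub \<subseteq> (UNIV :: 't set) \<rightarrow>\<^sub>E {..ub}"
    by (auto simp: Omega_q_def PiE_iff)
qed (simp add: finite_PiE)

lemma treated_u_count_in_Omega_q:
  fixes z :: "'s::finite \<Rightarrow> 't::finite"
  assumes "z \<in> assignments n"
  shows "treated_u_count u z \<in> Omega_q TYPE('s) n (u_total u)"
proof -
  let ?S = "{s. u s = 1}"
  have Q: "treated_u_count u z i = card {s \<in> ?S. z s = i}" for i
    by (simp add: treated_u_count_def Int_def conj_commute)
  have ub: "u_total u = card ?S"
    by (simp add: u_total_def)
  have "card (\<Union>i\<in>UNIV. {s \<in> ?S. z s = i}) = (\<Sum>i\<in>UNIV. card {s \<in> ?S. z s = i})"
    by (intro card_UN_disjoint) auto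
  moreover have "(\<Union>i\<in>UNIV. {s \<in> ?S. z s = i}) = ?S" by auto
  ultimately have sum: "(\<Sum>i\<in>UNIV. treated_u_count u z i) = u_total u"
    by (simp add: Q ub)
  have le: "treated_u_count u z i \<le> n i" "treated_u_count u z i \<le> u_total u" for i
  proof -
    have "n i = card {s. z s = i}"
      using assms by (simp add: assignments_def)
    then show "treated_u_count u z i \<le> n i" "treated_u_count u z i \<le> u_total u"
      by (auto simp only: Q ub intro!: card_mono finite)
  qed
  \<comment> \<open>Inclusion-exclusion: the subjects of level i and those with u = 1 together
    number at most N.\<close>
  have "n i + u_total u \<le> CARD('s) + treated_u_count u z i" for i
  proof -
    have "card {s. z s = i} + card ?S = card ({s. z s = i} \<union> ?S) + card ({s. z s = i} \<inter> ?S)"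
      by (rule card_Un_Int) auto
    moreover have "card ({s. z s = i} \<union> ?S) \<le> CARD('s)"
      by (rule card_mono) auto
    moreover have "{s. z s = i} \<inter> ?S = {s \<in> ?S. z s = i}" by auto
    ultimately show ?thesis
      using assms by (simp add: assignments_def Q ub)
  qed
  then have "int (n i) + int (u_total u) - int CARD('s) \<le> int (treated_u_count u z i)" for i
    by (smt (verit) of_nat_add of_nat_mono)
  then show ?thesis
    using sum le by (simp add: Omega_q_def)
qed

text \<open>The weight is constant on each fibre of Q, and the kernel counts the fibre. As
  \<open>Omega_q\<close> contains every attained value of Q, the sum over it regroups the
  normalising constant.\<close>

lemma prob_treated_u_count:
  fixes n :: "'t::finite \<Rightarrow> nat" and u :: "'s::finite \<Rightarrow> nat"
  assumes n: "(\<Sum>i\<in>UNIV. n i) = CARD('s)" and u: "\<And>s. u s \<in> {0, 1}"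
  shows "measure_pmf.prob (assignment_pmf n \<gamma> \<delta> u :: ('s \<Rightarrow> 't) pmf) {z. treated_u_count u z = q} =
    exp (\<gamma> * (\<Sum>i\<in>UNIV. real (\<delta> i) * real (q i))) * real (kernel_count q n u) /
    (\<Sum>q'\<in>Omega_q TYPE('s) n (u_total u).
       exp (\<gamma> * (\<Sum>i\<in>UNIV. real (\<delta> i) * real (q' i))) * real (kernel_count q' n u))"
proof -
  let ?Z = "assignments n :: ('s \<Rightarrow> 't) set" and ?w = "assignment_weight \<gamma> \<delta> u :: ('s \<Rightarrow> 't) \<Rightarrow> real"
  let ?e = "\<lambda>q. exp (\<gamma> * (\<Sum>i\<in>UNIV. real (\<delta> i) * real (q i)))"
  have fibre: "(\<Sum>z | z \<in> ?Z \<and> treated_u_count u z = q. ?w z) = ?e q * real (kernel_count q n u)" for q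
  proof -
    have "{z \<in> ?Z. \<forall>i. (\<Sum>s\<in>UNIV. of_bool (z s = i \<and> u s = 1)) = q i} =
        {z \<in> ?Z. treated_u_count u z = q}"
      by (auto simp only: fun_eq_iff treated_u_count_def)
    then have "kernel_count q n u = card {z \<in> ?Z. treated_u_count u z = q}"
      by (simp only: kernel_count_def)
    moreover have "(\<Sum>z | z \<in> ?Z \<and> treated_u_count u z = q. ?w z) =
        (\<Sum>z | z \<in> ?Z \<and> treated_u_count u z = q. ?e q)"
      by (intro sum.cong) (auto simp: assignment_weight_eq[OF u])
    ultimately show ?thesis by simp
  qed
  have total: "(\<Sum>q'\<in>Omega_q TYPE('s) n (u_total u). ?e q' * real (kernel_count q' n u)) = sum ?w ?Z"
    unfolding fibre[symmetric]
    by (rule sum.group) (auto simp: finite_Omega_q treated_u_count_in_Omega_q)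
  have "measure_pmf.prob (assignment_pmf n \<gamma> \<delta> u) {z :: 's \<Rightarrow> 't. treated_u_count u z = q} =
      (\<Sum>z | treated_u_count u z = q. pmf (assignment_pmf n \<gamma> \<delta> u) (z :: 's \<Rightarrow> 't))"
    by (rule measure_measure_pmf_finite) simp
  also have "\<dots> = (\<Sum>z | z \<in> ?Z \<and> treated_u_count u z = q. ?w z / sum ?w ?Z)"
    by (intro sum.mono_neutral_cong_right) (auto simp: pmf_assignment_pmf[OF n])
  also have "\<dots> = ?e q * real (kernel_count q n u) / sum ?w ?Z"
    by (simp only: fibre flip: sum_divide_distrib)
  finally show ?thesis
    by (simp only: total)
qed

section \<open>Outcome means and variances inside a stratum\<close>

lemma stratum_mean_eq:
  "stratum_mean r u j k = real (card {s. r s = j \<and> u s = k}) / real (card {s. u s = k})"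
  by (simp add: stratum_mean_def)

text \<open>Brings the sample variance into the shape of the factor \<open>w\<close> in
  \<open>within_cov_same_cell\<close>. The sum of squares collapses because an indicator equals its
  square.\<close>

lemma stratum_var_eq:
  fixes r :: "'s::finite \<Rightarrow> 'o" and u :: "'s \<Rightarrow> nat" and j :: 'o and k :: nat
  defines "a \<equiv> real (card {s. r s = j \<and> u s = k})" and "m \<equiv> real (card {s. u s = k})"
  shows "stratum_var r u j k = (a - a\<^sup>2 / m) / (m - 1)"
proof -
  let ?S = "{s. u s = k}" and ?A = "{s. r s = j \<and> u s = k}"
  have "(\<Sum>s\<in>?S. (of_bool (r s = j \<and> u s = k) - a / m)\<^sup>2) =
      (\<Sum>s\<in>?S. of_bool (r s = j \<and> u s = k) * (1 - 2 * (a / m)) + (a / m)\<^sup>2)"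
    by (intro sum.cong) (auto simp: power2_eq_square algebra_simps)
  also have "\<dots> = (\<Sum>s\<in>?S. of_bool (r s = j \<and> u s = k)) * (1 - 2 * (a / m)) + m * (a / m)\<^sup>2"
    by (simp only: sum.distrib flip: sum_distrib_right) (simp add: m_def)
  also have "(\<Sum>s\<in>?S. of_bool (r s = j \<and> u s = k)) = a"
    by (simp add: a_def Int_def conj_ac cong: conj_cong)
  also have "a * (1 - 2 * (a / m)) + m * (a / m)\<^sup>2 = a - a\<^sup>2 / m"
    by (cases "m = 0") (auto simp: field_simps power2_eq_square)
  finally show ?thesis
    by (simp add: stratum_var_def stratum_mean_eq a_def m_def)
qed


section \<open>Means, variances and covariances of the cell counts\<close>

theorem theoremD1:
  fixes n :: "'t::finite \<Rightarrow> nat"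
    and r :: "'s::finite \<Rightarrow> 'o::finite"
    and u :: "'s \<Rightarrow> nat"
    and \<delta> :: "'t \<Rightarrow> nat"
    and \<gamma> :: real
  assumes "\<And>i. n i > 0"
    and "(\<Sum>i\<in>UNIV. n i) = CARD('s)"
    and "\<And>s. u s \<in> {0, 1}"
    and "\<And>i. \<delta> i \<in> {0, 1}"
    and "\<gamma> \<ge> 0"
  shows
   "let p = (assignment_pmf n \<gamma> \<delta> u :: ('s \<Rightarrow> 't) pmf);
        E = measure_pmf.expectation p; Var = measure_pmf.variance p; Cov = covariance p;
        C = (\<lambda>i j z. real (cell_count r i j z));
        Q = (\<lambda>i z. real (treated_u_count u z i));
        N = real CARD('s);
        Ni = (\<lambda>i. real (n i));
        Nj = (\<lambda>j. real (outcome_total r j));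
        ub = real (u_total u);
        uj = (\<lambda>j. real (u_outcome_total r u j));
        \<rho> = stratum_mean r u;
        w = stratum_var r u;
        D = (\<lambda>j j'. \<rho> j 1 * \<rho> j' 1 + \<rho> j 0 * \<rho> j' 0 - \<rho> j 1 * \<rho> j' 0 - \<rho> j' 1 * \<rho> j 0);
        D2 = (\<lambda>j. (\<rho> j 1)\<^sup>2 + (\<rho> j 0)\<^sup>2 - 2 * \<rho> j 1 * \<rho> j 0);
        EQ0 = (\<lambda>i i'. E (\<lambda>z. Q i z * Q i' z) + Ni i * Ni i' - Ni i * E (Q i') - Ni i' * E (Q i));
        A1 = (\<lambda>i j j'. \<rho> j 1 * \<rho> j' 1 / (ub - 1) * (E (\<lambda>z. (Q i z)\<^sup>2) - ub * E (Q i)));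
        A0 = (\<lambda>i j j'. \<rho> j 0 * \<rho> j' 0 / (N - ub - 1) *
               (Ni i * (Ni i - N + ub) + E (\<lambda>z. (Q i z)\<^sup>2) - (2 * Ni i - N + ub) * E (Q i)));
        B1 = (\<lambda>i i' j. - (uj j * (ub - uj j) / (ub\<^sup>2 * (ub - 1))) * E (\<lambda>z. Q i z * Q i' z));
        B0 = (\<lambda>i i' j. (Nj j - uj j) * (Nj j - uj j - N + ub) / ((N - ub)\<^sup>2 * (N - ub - 1)) * EQ0 i i');
        C1 = (\<lambda>i i' j j'. \<rho> j 1 * \<rho> j' 1 / (ub - 1) * E (\<lambda>z. Q i z * Q i' z));
        C0 = (\<lambda>i i' j j'. \<rho> j 0 * \<rho> j' 0 / (N - ub - 1) * EQ0 i i')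
    in
      (\<forall>i j. E (C i j) = uj j / ub * E (Q i) + (Nj j - uj j) / (N - ub) * (Ni i - E (Q i))) \<and>
      (\<forall>i j. Var (C i j) =
          (w j 1 - w j 0) * E (Q i)
          - (w j 1 / ub + w j 0 / (N - ub)) * ((E (Q i))\<^sup>2 + Var (Q i))
          + Ni i * (N - ub - Ni i + 2 * E (Q i)) * w j 0 / (N - ub)
          + Var (Q i) * (\<rho> j 1 - \<rho> j 0)\<^sup>2) \<and>
      (\<forall>q. measure_pmf.prob p {z. treated_u_count u z = q} =
          exp (\<gamma> * (\<Sum>i\<in>UNIV. real (\<delta> i) * real (q i))) * real (kernel_count q n u) /
          (\<Sum>q'\<in>Omega_q TYPE('s) n (u_total u).
             exp (\<gamma> * (\<Sum>i\<in>UNIV. real (\<delta> i) * real (q' i))) * real (kernel_count q' n u))) \<and>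
      (1 < ub \<and> ub < N - 1 \<longrightarrow>
        (\<forall>i j j'. j \<noteq> j' \<longrightarrow>
          Cov (C i j) (C i j') = A1 i j j' + A0 i j j' + D j j' * Var (Q i)) \<and>
        (\<forall>i i' j. i \<noteq> i' \<longrightarrow>
          Cov (C i j) (C i' j) = D2 j * Cov (Q i) (Q i') + B1 i i' j + B0 i i' j) \<and>
        (\<forall>i i' j j'. i \<noteq> i' \<longrightarrow> j \<noteq> j' \<longrightarrow>
          Cov (C i j) (C i' j') = D j j' * Cov (Q i) (Q i') + C1 i i' j j' + C0 i i' j j')) \<and>
      (ub = N - 1 \<longrightarrow>
        (\<forall>i j j'. j \<noteq> j' \<longrightarrow>
          Cov (C i j) (C i j') = A1 i j j' + D j j' * Var (Q i)) \<and>
        (\<forall>i i' j. i \<noteq> i' \<longrightarrow>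
          Cov (C i j) (C i' j) = D2 j * Cov (Q i) (Q i') + B1 i i' j) \<and>
        (\<forall>i i' j j'. i \<noteq> i' \<longrightarrow> j \<noteq> j' \<longrightarrow>
          Cov (C i j) (C i' j') = D j j' * Cov (Q i) (Q i') + C1 i i' j j')) \<and>
      (ub = 1 \<longrightarrow>
        (\<forall>i j j'. j \<noteq> j' \<longrightarrow>
          Cov (C i j) (C i j') = A0 i j j' + D j j' * Var (Q i)) \<and>
        (\<forall>i i' j. i \<noteq> i' \<longrightarrow>
          Cov (C i j) (C i' j) = D2 j * Cov (Q i) (Q i') + B0 i i' j) \<and>
        (\<forall>i i' j j'. i \<noteq> i' \<longrightarrow> j \<noteq> j' \<longrightarrow>
          Cov (C i j) (C i' j') = D j j' * Cov (Q i) (Q i') + C0 i i' j j')) \<and>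
      (ub = 0 \<or> ub = N \<longrightarrow>
        (\<forall>i j j'. j \<noteq> j' \<longrightarrow>
          Cov (C i j) (C i j') = - (Nj j * Nj j' * Ni i * (N - Ni i)) / (N\<^sup>2 * (N - 1))) \<and>
        (\<forall>i i' j. i \<noteq> i' \<longrightarrow>
          Cov (C i j) (C i' j) = - (Nj j * (N - Nj j) * Ni i * Ni i') / (N\<^sup>2 * (N - 1))) \<and>
        (\<forall>i i' j j'. i \<noteq> i' \<longrightarrow> j \<noteq> j' \<longrightarrow>
          Cov (C i j) (C i' j') = Nj j * Nj j' * Ni i * Ni i' / (N\<^sup>2 * (N - 1))))"
proof -
  define p where "p = (assignment_pmf n \<gamma> \<delta> u :: ('s \<Rightarrow> 't) pmf)"
  \<comment> \<open>All claims on moments are reduced to identities in the stratum sizes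
    \<open>m\<close> (u = 1) and \<open>k\<close> (u = 0), the outcome counts \<open>a\<close> and
    \<open>b\<close> in these strata, the first and second moments \<open>x\<close> and
    \<open>y\<close> of Q, and the margins \<open>c\<close>.\<close>
  define S where "S k = {s. u s = k}" for k
  define A where "A k j = {s. r s = j \<and> u s = k}" for k j
  define m k where "m = real (card (S 1))" and "k = real (card (S 0))"
  define a b where "a j = real (card (A 1 j))" and "b j = real (card (A 0 j))" for j
  define x where "x i = measure_pmf.expectation p (level_count (S 1) i)" for i
  define y where "y i i' = measure_pmf.expectation p (\<lambda>z. level_count (S 1) i z * level_count (S 1) i' z)"
    for i i'
  define c where "c i = real (n i)" for i
  have ex: "exchangeable_on p (S l)" for l
    unfolding p_def S_def by (rule exchangeable_on_assignment_pmf) (rule assms(2))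
  have disj: "S 1 \<inter> S 0 = {}" "A 1 j \<inter> A 0 j = {}" for j
    by (auto simp: S_def A_def)
  have sub: "A l j \<subseteq> S l" for l j
    by (auto simp: S_def A_def)
  have disj_out: "A l j \<inter> A l j' = {}" if "j \<noteq> j'" for l j j'
    using that by (auto simp: A_def)
  have u01: "u s = 0 \<or> u s = 1" for s
    using assms(3)[of s] by simp
  have univ: "S 1 \<union> S 0 = UNIV" "A 1 j \<union> A 0 j = {s. r s = j}" for j
    unfolding S_def A_def using u01 by blast+
  \<comment> \<open>Every z in the support has the prescribed margins, and the two strata exhaust
    all subjects.\<close>
  have margin: "level_count (S 0) i z = c i - level_count (S 1) i z" if "z \<in> set_pmf p" for z i
  proof -
    have "z \<in> assignments n"
      using that pmf_assignment_pmf[OF assms(2), of \<gamma> \<delta> u z]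
      by (auto simp: p_def set_pmf_iff split: if_splits)
    then have "level_count (S 1 \<union> S 0) i z = c i"
      by (simp only: univ c_def level_count_eq_card[OF finite]) (simp add: assignments_def)
    then show ?thesis
      using level_count_Un_disjoint[OF finite finite disj(1), of i z] by simp
  qed
  have N: "real CARD('s) = m + k"
    unfolding m_def k_def univ(1)[symmetric]
    by (subst card_Un_disjoint) (use disj in auto)
  have Nj: "real (outcome_total r j) = a j + b j" for j
    unfolding a_def b_def outcome_total_def univ(2)[symmetric]
    by (subst card_Un_disjoint) (use disj in auto)
  have ub: "real (u_total u) = m"
    by (simp add: u_total_def m_def S_def)
  have uj: "real (u_outcome_total r u j) = a j" for j
    by (simp add: u_outcome_total_def a_def A_def)
  have mean: "stratum_mean r u j 1 = a j / m" "stratum_mean r u j 0 = b j / k" for j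
    by (simp_all add: stratum_mean_eq a_def b_def m_def k_def S_def A_def)
  have var: "stratum_var r u j 1 = (a j - (a j)\<^sup>2 / m) / (m - 1)"
    "stratum_var r u j 0 = (b j - (b j)\<^sup>2 / k) / (k - 1)" for j
    by (simp_all only: stratum_var_eq a_def b_def m_def k_def S_def A_def)
  have C: "real (cell_count r i j z) = level_count (A 1 j) i z + level_count (A 0 j) i z"
    for i j and z :: "'s \<Rightarrow> 't"
    unfolding level_count_Un_disjoint[OF finite finite disj(2), symmetric] univ
    by (simp add: cell_count_def level_count_def Int_def conj_commute)
  have Q: "real (treated_u_count u z i) = level_count (S 1) i z" for i and z :: "'s \<Rightarrow> 't"
    by (simp add: treated_u_count_eq_level_count S_def)
  have x0: "measure_pmf.expectation p (level_count (S 0) i) = c i - x i" for i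
    unfolding x_def by (rule expectation_complement) (rule margin)
  have y0: "measure_pmf.expectation p (\<lambda>z. level_count (S 0) i z * level_count (S 0) i' z) =
      y i i' + c i * c i' - c i * x i' - c i' * x i" for i i'
    unfolding x_def y_def by (rule expectation_complement_mult_complement) (rule margin)
  have covQ: "covariance p (level_count (S 1) i) (level_count (S 1) i') = y i i' - x i * x i'" for i i'
    by (simp add: covariance_eq x_def y_def)
  have EC: "measure_pmf.expectation p (\<lambda>z. level_count (A 1 j) i z + level_count (A 0 j) i z) =
      a j / m * x i + b j / k * (c i - x i)" for i j
  proof -
    have "measure_pmf.expectation p (level_count (A 1 j) i) = a j / m * x i"
      "measure_pmf.expectation p (level_count (A 0 j) i) = b j / k * (c i - x i)"
      unfolding a_def b_def m_def k_def x0[symmetric] unfolding x_def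
      by (rule expectation_level_count_exchangeable[OF ex sub])+
    then show ?thesis by simp
  qed
  have cov: "covariance p (\<lambda>z. level_count (A 1 j) i z + level_count (A 0 j) i z)
      (\<lambda>z. level_count (A 1 j') i' z + level_count (A 0 j') i' z) =
    within_cov p (S 1) (A 1 j) (A 1 j') i i' + within_cov p (S 0) (A 0 j) (A 0 j') i i'
    + (a j / m - b j / k) * (a j' / m - b j' / k) * (y i i' - x i * x i')" for i i' j j'
    unfolding a_def b_def m_def k_def covQ[symmetric]
    by (rule covariance_two_strata[where c = c, OF ex ex disj(1) sub sub sub sub]) (rule margin)
  have W_disj: "within_cov p (S 1) (A 1 j) (A 1 j') i i' =
      a j / m * (a j' / m) / (m - 1) * (y i i' - of_bool (i = i') * m * x i)"
    "within_cov p (S 0) (A 0 j) (A 0 j') i i' =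
      b j / k * (b j' / k) / (k - 1) *
      (y i i' + c i * c i' - c i * x i' - c i' * x i - of_bool (i = i') * k * (c i - x i))"
    if "j \<noteq> j'" for i i' j j'
    unfolding within_cov_disjoint[OF ex sub sub disj_out[OF that]] x0 y0
    by (simp_all only: a_def b_def m_def k_def x_def y_def)
  have W_out: "within_cov p (S 1) (A 1 j) (A 1 j) i i' =
      - (a j * (m - a j) / (m\<^sup>2 * (m - 1))) * y i i'"
    "within_cov p (S 0) (A 0 j) (A 0 j) i i' =
      - (b j * (k - b j) / (k\<^sup>2 * (k - 1))) * (y i i' + c i * c i' - c i * x i' - c i' * x i)"
    if "i \<noteq> i'" for i i' j
    unfolding within_cov_same_outcome[OF ex sub that] y0
    by (simp_all only: a_def b_def m_def k_def x_def y_def)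
  have W_cell: "within_cov p (S 1) (A 1 j) (A 1 j) i i =
      (a j - (a j)\<^sup>2 / m) / (m - 1) * x i - (a j - (a j)\<^sup>2 / m) / (m - 1) / m * y i i"
    "within_cov p (S 0) (A 0 j) (A 0 j) i i =
      (b j - (b j)\<^sup>2 / k) / (k - 1) * (c i - x i)
      - (b j - (b j)\<^sup>2 / k) / (k - 1) / k * (y i i + c i * c i - c i * x i - c i * x i)"
    for i j
    unfolding within_cov_same_cell[OF ex sub] x0 y0
    by (simp_all only: a_def b_def m_def k_def x_def y_def)
  have m0: "a j = 0" "x i = 0" "y i i' = 0" if "m = 0" for i i' j
    using that sub[of 1 j] by (simp_all add: m_def a_def x_def y_def)
  have k0: "b j = 0" if "k = 0" for j
    using that sub[of 0 j] by (simp add: k_def b_def)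
  \<comment> \<open>If nobody has u = 0, then Q_i is constantly the margin; its moments are read off
    from the vanishing moments of the empty stratum.\<close>
  have k0': "x i = c i" "y i i' = c i * c i'" if "k = 0" for i i'
  proof -
    have "S 0 = {}" using that by (simp add: k_def)
    then have "c i - x i = 0" "y i i' + c i * c i' - c i * x i' - c i' * x i = 0" "c i' - x i' = 0"
      unfolding x0[symmetric] y0[symmetric] by simp_all
    then show "x i = c i" "y i i' = c i * c i'" by (simp_all add: algebra_simps)
  qed
  \<comment> \<open>This covariance and the next two carry no hypothesis on \<open>m\<close> and
    \<open>k\<close>, so each range of \<open>m\<close> in the theorem is a specialisation.\<close>
  have cov_same_treatment: "covariance p (\<lambda>z. level_count (A 1 j) i z + level_count (A 0 j) i z)
      (\<lambda>z. level_count (A 1 j') i z + level_count (A 0 j') i z) =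
    a j / m * (a j' / m) / (m - 1) * (y i i - m * x i)
    + b j / k * (b j' / k) / (k - 1) * (c i * (c i - k) + y i i - (2 * c i - k) * x i)
    + (a j / m * (a j' / m) + b j / k * (b j' / k) - a j / m * (b j' / k) - a j' / m * (b j / k))
      * (y i i - x i * x i)" if "j \<noteq> j'" for i j j'
  proof -
    have "y i i + c i * c i - c i * x i - c i * x i - k * (c i - x i) =
        c i * (c i - k) + y i i - (2 * c i - k) * x i"
      "(a j / m - b j / k) * (a j' / m - b j' / k) =
        a j / m * (a j' / m) + b j / k * (b j' / k) - a j / m * (b j' / k) - a j' / m * (b j / k)"
      by (simp_all add: algebra_simps)
    then show ?thesis
      unfolding cov W_disj[OF that] by simp
  qed
  have cov_same_outcome: "covariance p (\<lambda>z. level_count (A 1 j) i z + level_count (A 0 j) i z)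
      (\<lambda>z. level_count (A 1 j) i' z + level_count (A 0 j) i' z) =
    ((a j / m)\<^sup>2 + (b j / k)\<^sup>2 - 2 * (a j / m) * (b j / k)) * (y i i' - x i * x i')
    + - (a j * (m - a j) / (m\<^sup>2 * (m - 1))) * y i i'
    + b j * (b j - k) / (k\<^sup>2 * (k - 1)) * (y i i' + c i * c i' - c i * x i' - c i' * x i)"
    if "i \<noteq> i'" for i i' j
  proof -
    \<comment> \<open>B_0 carries its sign in the factor \<open>b j - k\<close>, whereas B_1 has it
      in front.\<close>
    have "- (b j * (k - b j) / (k\<^sup>2 * (k - 1))) = b j * (b j - k) / (k\<^sup>2 * (k - 1))"
      by (simp only: minus_divide_left mult_minus_right[symmetric] minus_diff_eq)
    moreover have "(a j / m - b j / k) * (a j / m - b j / k) =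
        (a j / m)\<^sup>2 + (b j / k)\<^sup>2 - 2 * (a j / m) * (b j / k)"
      by (simp add: algebra_simps power2_eq_square)
    ultimately show ?thesis
      unfolding cov W_out[OF that] by simp
  qed
  have cov_different: "covariance p (\<lambda>z. level_count (A 1 j) i z + level_count (A 0 j) i z)
      (\<lambda>z. level_count (A 1 j') i' z + level_count (A 0 j') i' z) =
    (a j / m * (a j' / m) + b j / k * (b j' / k) - a j / m * (b j' / k) - a j' / m * (b j / k))
      * (y i i' - x i * x i')
    + a j / m * (a j' / m) / (m - 1) * y i i'
    + b j / k * (b j' / k) / (k - 1) * (y i i' + c i * c i' - c i * x i' - c i' * x i)"
    if "i \<noteq> i'" "j \<noteq> j'" for i i' j j'
  proof -
    have "(a j / m - b j / k) * (a j' / m - b j' / k) =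
        a j / m * (a j' / m) + b j / k * (b j' / k) - a j / m * (b j' / k) - a j' / m * (b j / k)"
      by (simp add: algebra_simps)
    then show ?thesis
      unfolding cov W_disj[OF that(2)] using that by simp
  qed
  have var_cell: "measure_pmf.variance p (\<lambda>z. level_count (A 1 j) i z + level_count (A 0 j) i z) =
    ((a j - (a j)\<^sup>2 / m) / (m - 1) - (b j - (b j)\<^sup>2 / k) / (k - 1)) * x i
    - ((a j - (a j)\<^sup>2 / m) / (m - 1) / m + (b j - (b j)\<^sup>2 / k) / (k - 1) / k) * y i i
    + c i * (k - c i + 2 * x i) * ((b j - (b j)\<^sup>2 / k) / (k - 1)) / k
    + (y i i - x i * x i) * (a j / m - b j / k)\<^sup>2" for i j
  proof -
    define v w where "v = (a j - (a j)\<^sup>2 / m) / (m - 1)" and "w = (b j - (b j)\<^sup>2 / k) / (k - 1)"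
    \<comment> \<open>The next identity divides by \<open>k\<close>; for \<open>k = 0\<close> it
      holds because \<open>w\<close> vanishes.\<close>
    have "w = 0" if "k = 0" using k0[OF that] by (simp add: w_def)
    then have "w * (c i - x i) - w / k * (y i i + c i * c i - c i * x i - c i * x i) =
        - w * x i - w / k * y i i + c i * (k - c i + 2 * x i) * w / k"
      by (cases "k = 0") (simp_all add: field_simps)
    then show ?thesis
      unfolding variance_eq_covariance cov W_cell v_def[symmetric] w_def[symmetric]
      by (simp add: algebra_simps power2_eq_square)
  qed
  have varQ: "measure_pmf.variance p (level_count (S 1) i) = y i i - x i * x i" for i
    by (simp only: variance_eq_covariance covQ)
  \<comment> \<open>With an empty stratum Q is constant, so the term between the strata drops
    out.\<close>
  have degenerate: "y i i' - x i * x i' = 0" if "m = 0 \<or> k = 0" for i i'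
    using that m0 k0' by auto
  \<comment> \<open>These match the forms of the statement: N - ub is \<open>k\<close>, and E[Q]^2 +
    Var[Q] is the second moment.\<close>
  have cancel: "v - (m + k) + m = v - k" "(x i)\<^sup>2 + (y i i - x i * x i) = y i i" for v i
    by (simp_all add: power2_eq_square)
  show ?thesis
    unfolding Let_def p_def[symmetric] N Nj ub uj mean var C Q c_def[symmetric]
    apply (simp only: varQ var_cell covQ)
    apply (simp only: add_diff_cancel_left' cancel power2_eq_square[of "level_count _ _ _"] EC
        x_def[symmetric] y_def[symmetric])
  \<comment> \<open>The mean and the variance come first and are left to the closing
    \<open>simp_all\<close>; after the law of Q, the covariances follow in blocks of three.\<close>
  proof (intro conjI allI impI, goal_cases)
    case (3 q)
    then show ?case
      unfolding p_def by (rule prob_treated_u_count) (rule assms)+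
  next
    case (4 i j j')
    then show ?case by (simp only: cov_same_treatment not_False_eq_True)
  next
    case (5 i i' j)
    then show ?case by (simp only: cov_same_outcome not_False_eq_True)
  next
    case (6 i i' j j')
    then show ?case by (simp only: cov_different not_False_eq_True)
  next
    \<comment> \<open>Here \<open>k = 1\<close>, and the terms A_0, B_0, C_0 vanish as quotients by
      zero.\<close>
    case (7 i j j')
    then show ?case unfolding cov_same_treatment[OF 7(2)] by simp
  next
    case (8 i i' j)
    then show ?case unfolding cov_same_outcome[OF 8(2)] by simp
  next
    case (9 i i' j j')
    then show ?case unfolding cov_different[OF 9(2,3)] by simp
  next
    \<comment> \<open>Symmetrically, \<open>m = 1\<close> removes A_1, B_1, C_1.\<close>
    case (10 i j j')
    then show ?case unfolding cov_same_treatment[OF 10(2)] by simp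
  next
    case (11 i i' j)
    then show ?case unfolding cov_same_outcome[OF 11(2)] by simp
  next
    case (12 i i' j j')
    then show ?case unfolding cov_different[OF 12(2,3)] by simp
  next
    \<comment> \<open>Only the non-empty stratum contributes, and it consists of all subjects. For
      \<open>k = 0\<close> the moments of Q are those of the constant margins; for
      \<open>m = 0\<close> they are 0.\<close>
    case (13 i j j')
    then have mk: "m = 0 \<or> k = 0" by simp
    show ?case
      unfolding cov_same_treatment[OF 13(2)] degenerate[OF mk]
      using mk by (auto simp: m0 k0 k0' power2_eq_square algebra_simps diff_divide_distrib add_divide_distrib)
  next
    case (14 i i' j)
    then have mk: "m = 0 \<or> k = 0" by simp
    show ?case
      unfolding cov_same_outcome[OF 14(2)] degenerate[OF mk]
      using mk by (auto simp: m0 k0 k0' power2_eq_square algebra_simps diff_divide_distrib add_divide_distrib)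
  next
    case (15 i i' j j')
    then have mk: "m = 0 \<or> k = 0" by simp
    show ?case
      unfolding cov_different[OF 15(2,3)] degenerate[OF mk]
      using mk by (auto simp: m0 k0 k0' power2_eq_square algebra_simps)
  qed simp_all
qed

end
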